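(* Let $n\geq3$, and for a cyclic $n$-gon $\{x_0,\ldots,x_{n-1}\}$ with side length collection $(d_0,\ldots,d_{n-1})$ and circumcircle radius $J$ let $d_{i_0}$ be maximal among the $d_i$. (1) The angle from $x_{i-1}$ to $x_i$ is less than $\pi$ for each $i$ (indices mod $n$) if and only if $\sum_{i\neq i_0}\theta(d_i,J)>\pi$; in this case the cyclic $n$-gon is called centered. The collection $$\mathcal{C}_n=\Big\{(d_0,\ldots,d_{n-1})\in(0,\infty)^n : \sum_{i=0}^{n-1}\theta(d_i,d_{i_0}/2)>2\pi,\text{ where } d_{i_0}=\max\{d_i\}_{i=0}^{n-1}\Big\}$$ is contained in $\mathcal{AC}_n$ and parametrizes marked, centered $n$-gons in $\mathbb{H}^2$ up to hyperbolic isometry, by their side length collections. (2) $J=d_{i_0}/2$ if and only if $\sum_{i\neq i_0}\theta(d_i,J)=\pi$; in this case the cyclic $n$-gon is called semicyclic. The collection $$\mathcal{BC}_n=\Big\{(d_0,\ldots,d_{n-1})\in(0,\infty)^n : \sum_{i=0}^{n-1}\theta(d_i,d_{i_0}/2)=2\pi,\text{ where } d_{i_0}=\max\{d_i\}_{i=0}^{n-1}\Big\}$$ is contained in $\mathcal{AC}_n$ and parametrizes marked, semicyclic $n$-gons in $\mathbb{H}^2$ up to hyperbolic isometry, by their side length collections.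
   Context: For $d>0$ and $J\geq d/2$ let $\theta(d,J)=2\sin^{-1}(\sinh(d/2)/\sinh J)\in[0,\pi]$. Let $$\mathcal{AC}_n=\Big\{(d_0,\ldots,d_{n-1})\in(0,\infty)^n : \sinh(d_i/2)<\sum_{j\neq i}\sinh(d_j/2)\text{ for each } i\Big\}.$$ For points $x,y$ on a hyperbolic circle $C$ in the hyperbolic plane $\mathbb{H}^2$, $[x,y]$ denotes the arc of $C$ running counterclockwise from $x$ to $y$, and the angle from $x$ to $y$ is the angle (in $(0,2\pi)$ for $x\ne y$) subtended by $[x,y]$ at the center of $C$. A cyclic $n$-gon with side length collection $(d_0,\ldots,d_{n-1})\in(0,\infty)^n$ is a collection $\{x_0,\ldots,x_{n-1}\}$ on a hyperbolic circle (its circumcircle, whose radius is the circumcircle radius) that is cyclically ordered, i.e. for all $i$ with $1\le i\le n-1$ the arc $(x_{i-1},x_i]=[x_{i-1},x_i]-\{x_{i-1}\}$ contains no $x_j$ for $j\neq i$, and such that $\mathrm{dist}(x_{i-1},x_i)=d_i$ for each $i>0$ and $\mathrm{dist}(x_0,x_{n-1})=d_0$. A marking is a choice of the vertex labeled $x_0$. A set $S$ parametrizes a class of marked $n$-gons up to isometry by side length collections if the map sending a marked $n$-gon of the class to its side length collection induces a bijection from the set of isometry classes (an isometry of marked $n$-gons is an isometry of $\mathbb{H}^2$ taking $x_i'$ to $x_i$ for all $i$) onto $S$. *)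

theory Defs
  imports "HOL-Complex_Analysis.Complex_Analysis"
begin

text \<open>
  The hyperbolic plane is the Poincare disc model (curvature -1), with the orientation
  of the complex plane.
\<close>

definition hyp_plane :: "complex set" where
  "hyp_plane = ball 0 1"

definition hdist :: "complex \<Rightarrow> complex \<Rightarrow> real" where
  "hdist z w = arcosh (1 + 2 * (cmod (z - w))\<^sup>2 / ((1 - (cmod z)\<^sup>2) * (1 - (cmod w)\<^sup>2)))"

definition hyp_isometry :: "(complex \<Rightarrow> complex) \<Rightarrow> bool" where
  "hyp_isometry f \<longleftrightarrow> bij_betw f hyp_plane hyp_plane \<and>
     (\<forall>z\<in>hyp_plane. \<forall>w\<in>hyp_plane. hdist (f z) (f w) = hdist z w)"

definition hcircle :: "complex \<Rightarrow> real \<Rightarrow> complex set" where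
  "hcircle c r = {z \<in> hyp_plane. hdist c z = r}"

text \<open>
  The counterclockwise angle in $[0,2\pi)$ at \<open>c\<close> from the geodesic ray through \<open>x\<close> to the one
  through \<open>y\<close> (for \<open>x\<close>, \<open>y\<close> different from \<open>c\<close>). \<open>Moebius_function 0 c z = (z - c) / (1 - cnj c * z)\<close>
  is an orientation-preserving isometry taking \<open>c\<close> to \<open>0\<close>, where geodesic rays are Euclidean
  radii and hyperbolic and Euclidean angles coincide.
\<close>

definition hangle :: "complex \<Rightarrow> complex \<Rightarrow> complex \<Rightarrow> real" where
  "hangle c x y = Arg2pi (Moebius_function 0 c y / Moebius_function 0 c x)"

text \<open>The arc $[x,y]$ of \<open>hcircle c r\<close> running counterclockwise from \<open>x\<close> to \<open>y\<close>.\<close>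

definition ccw_arc :: "complex \<Rightarrow> real \<Rightarrow> complex \<Rightarrow> complex \<Rightarrow> complex set" where
  "ccw_arc c r x y = {z \<in> hcircle c r. hangle c x z \<le> hangle c x y}"

text \<open>
  An $n$-tuple is a function on \<open>nat\<close> that is extensional outside \<open>{..<n}\<close>. A marked $n$-gon is the
  tuple of its vertices in cyclic order, the marked vertex having index \<open>0\<close>.
\<close>

text \<open>The index $i - 1$ modulo $n$.\<close>

definition prev :: "nat \<Rightarrow> nat \<Rightarrow> nat" where
  "prev n i = (if i = 0 then n - 1 else i - 1)"

definition side_lengths :: "nat \<Rightarrow> (nat \<Rightarrow> complex) \<Rightarrow> nat \<Rightarrow> real" where
  "side_lengths n x = (\<lambda>i\<in>{..<n}. hdist (x (prev n i)) (x i))"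

definition cyclic_ngon :: "nat \<Rightarrow> complex \<Rightarrow> real \<Rightarrow> (nat \<Rightarrow> complex) \<Rightarrow> bool" where
  "cyclic_ngon n c J x \<longleftrightarrow>
     c \<in> hyp_plane \<and> J > 0 \<and>
     x \<in> {..<n} \<rightarrow>\<^sub>E hcircle c J \<and>
     side_lengths n x \<in> {..<n} \<rightarrow>\<^sub>E {0<..} \<and>
     (\<forall>i\<in>{1..<n}. \<forall>j\<in>{..<n} - {i}. x j \<notin> ccw_arc c J (x (i - 1)) (x i) - {x (i - 1)})"

definition centered_ngons :: "nat \<Rightarrow> (nat \<Rightarrow> complex) set" where
  "centered_ngons n =
     {x. \<exists>c J. cyclic_ngon n c J x \<and> (\<forall>i<n. hangle c (x (prev n i)) (x i) < pi)}"

definition semicyclic_ngons :: "nat \<Rightarrow> (nat \<Rightarrow> complex) set" where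
  "semicyclic_ngons n =
     {x. \<exists>c J. cyclic_ngon n c J x \<and> J = Max (side_lengths n x ` {..<n}) / 2}"

definition ngon_isometric :: "nat \<Rightarrow> (nat \<Rightarrow> complex) set \<Rightarrow> ((nat \<Rightarrow> complex) \<times> (nat \<Rightarrow> complex)) set"
  where
  "ngon_isometric n M =
     {(x', x). x' \<in> M \<and> x \<in> M \<and> (\<exists>f. hyp_isometry f \<and> (\<forall>i<n. f (x' i) = x i))}"

text \<open>By congruence, \<open>side_lengths n ` K\<close> is a singleton for each isometry class \<open>K\<close>.\<close>

definition parametrizes :: "nat \<Rightarrow> (nat \<Rightarrow> real) set \<Rightarrow> (nat \<Rightarrow> complex) set \<Rightarrow> bool" where
  "parametrizes n S M \<longleftrightarrow>
     congruent (ngon_isometric n M) (side_lengths n) \<and>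
     bij_betw (\<lambda>K. the_elem (side_lengths n ` K)) (M // ngon_isometric n M) S"

definition theta :: "real \<Rightarrow> real \<Rightarrow> real" where
  "theta d J = 2 * arcsin (sinh (d / 2) / sinh J)"

definition AC :: "nat \<Rightarrow> (nat \<Rightarrow> real) set" where
  "AC n = {d \<in> {..<n} \<rightarrow>\<^sub>E {0<..}.
     \<forall>i<n. sinh (d i / 2) < (\<Sum>j\<in>{..<n} - {i}. sinh (d j / 2))}"

definition CC :: "nat \<Rightarrow> (nat \<Rightarrow> real) set" where
  "CC n = {d \<in> {..<n} \<rightarrow>\<^sub>E {0<..}.
     (\<Sum>i<n. theta (d i) (Max (d ` {..<n}) / 2)) > 2 * pi}"

definition BC :: "nat \<Rightarrow> (nat \<Rightarrow> real) set" where
  "BC n = {d \<in> {..<n} \<rightarrow>\<^sub>E {0<..}.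
     (\<Sum>i<n. theta (d i) (Max (d ` {..<n}) / 2)) = 2 * pi}"

end

theory Submission
  imports Defs
begin

text \<open>
  A side of length \<open>d\<close> of a cyclic polygon of radius \<open>J\<close> subtends at the center an angle \<open>a\<close> with
  \<open>sinh (d / 2) = sinh J * sin (a / 2)\<close>, so \<open>theta d J\<close> is \<open>a\<close> or \<open>2 * pi - a\<close>, and the cyclic
  order of the vertices says that these angles sum to \<open>2 * pi\<close>. Only a longest side can subtend an
  angle of at least \<open>pi\<close>; hence the thetas of the other sides sum to \<open>2 * pi\<close> minus the angle of the
  longest one, which gives the two criteria. If all angles are at most \<open>pi\<close>, then the thetas sum to
  \<open>2 * pi\<close>; as this sum is strictly decreasing in the radius, the side lengths determine the radius,
  then the angles, and then the polygon up to isometry. The intermediate value theorem produces the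
  radius for given side lengths.
\<close>

section \<open>Distance and isometries in the disc model\<close>

lemma hyp_plane_iff: "z \<in> hyp_plane \<longleftrightarrow> cmod z < 1"
  by (simp add: hyp_plane_def)

lemma one_minus_cmod_power2_pos: "0 < 1 - (cmod z)\<^sup>2" if "z \<in> hyp_plane"
  using that by (simp add: hyp_plane_iff power_less_one_iff abs_square_less_1)

text \<open>With \<open>q\<close> the quotient on the right, \<open>hdist\<close> is defined by cosh
  = 1 + 2q, and the double-angle formula cosh(2t) = 1 + 2 sinh(t)^2 turns this into sinh(t)^2 = q at
  half the distance. Chord computations use this form.\<close>

lemma
  assumes "z \<in> hyp_plane" "w \<in> hyp_plane"
  shows hdist_nonneg: "0 \<le> hdist z w"
    and sinh_half_hdist:
      "(sinh (hdist z w / 2))\<^sup>2 = (cmod (z - w))\<^sup>2 / ((1 - (cmod z)\<^sup>2) * (1 - (cmod w)\<^sup>2))"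
proof -
  define q where "q = (cmod (z - w))\<^sup>2 / ((1 - (cmod z)\<^sup>2) * (1 - (cmod w)\<^sup>2))"
  have "0 \<le> q"
    using assms[THEN one_minus_cmod_power2_pos] unfolding q_def by simp
  moreover have h: "hdist z w = arcosh (1 + 2 * q)"
    by (simp add: hdist_def q_def)
  ultimately show "0 \<le> hdist z w"
    using arcosh_nonneg_real[of "1 + 2 * q"] by linarith
  have "cosh (2 * (hdist z w / 2)) = 1 + 2 * q"
    using \<open>0 \<le> q\<close> by (simp add: h)
  then have "2 * (sinh (hdist z w / 2))\<^sup>2 = 2 * q"
    unfolding cosh_double cosh_square_eq by simp
  then show "(sinh (hdist z w / 2))\<^sup>2 = (cmod (z - w))\<^sup>2 / ((1 - (cmod z)\<^sup>2) * (1 - (cmod w)\<^sup>2))"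
    by (simp add: q_def)
qed

lemma Moebius_denominator_nonzero:
  assumes "c \<in> hyp_plane" "z \<in> hyp_plane"
  shows "1 - cnj c * z \<noteq> 0"
proof
  assume "1 - cnj c * z = 0"
  then have "cmod (cnj c * z) = 1"
    by (metis eq_iff_diff_eq_0 norm_one)
  then show False
    using norm_mult_less[of "cnj c" 1 z 1] assms by (simp add: hyp_plane_iff)
qed

text \<open>Rests on the identity |1 - cnj c * z|^2 - |z - c|^2 = (1 - |c|^2)(1 - |z|^2).\<close>

lemma one_minus_cmod_Moebius:
  assumes "c \<in> hyp_plane" "z \<in> hyp_plane"
  shows "1 - (cmod (Moebius_function 0 c z))\<^sup>2 =
    (1 - (cmod c)\<^sup>2) * (1 - (cmod z)\<^sup>2) / (cmod (1 - cnj c * z))\<^sup>2"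
proof -
  have "(cmod (1 - cnj c * z))\<^sup>2 - (cmod (z - c))\<^sup>2 = (1 - (cmod c)\<^sup>2) * (1 - (cmod z)\<^sup>2)"
    unfolding cmod_power2 by (simp add: algebra_simps power2_eq_square)
  then show ?thesis
    using Moebius_denominator_nonzero[OF assms]
    by (simp add: Moebius_function_simple norm_divide field_simps)
qed

lemma Moebius_diff:
  assumes "c \<in> hyp_plane" "z \<in> hyp_plane" "w \<in> hyp_plane"
  shows "Moebius_function 0 c z - Moebius_function 0 c w =
    (z - w) * of_real (1 - (cmod c)\<^sup>2) / ((1 - cnj c * z) * (1 - cnj c * w))"
proof -
  have "(z - c) * (1 - cnj c * w) - (w - c) * (1 - cnj c * z) = (z - w) * (1 - c * cnj c)"
    by (simp add: algebra_simps)
  also have "1 - c * cnj c = of_real (1 - (cmod c)\<^sup>2)"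
    by (simp add: complex_norm_square[symmetric])
  finally show ?thesis
    using Moebius_denominator_nonzero[of c] assms
    by (simp add: Moebius_function_simple diff_frac_eq)
qed

text \<open>The quotient inside \<open>arcosh\<close> is invariant: numerator and denominator both
  acquire the factor (1 - |c|^2)^2 / (|1 - cnj c * z|^2 |1 - cnj c * w|^2), which cancels.\<close>

lemma hdist_Moebius:
  assumes "c \<in> hyp_plane" "z \<in> hyp_plane" "w \<in> hyp_plane"
  shows "hdist (Moebius_function 0 c z) (Moebius_function 0 c w) = hdist z w"
proof -
  have dist: "(cmod (Moebius_function 0 c z - Moebius_function 0 c w))\<^sup>2 =
      (cmod (z - w))\<^sup>2 * (1 - (cmod c)\<^sup>2)\<^sup>2 / ((cmod (1 - cnj c * z))\<^sup>2 * (cmod (1 - cnj c * w))\<^sup>2)"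
    unfolding Moebius_diff[OF assms] norm_divide norm_mult
    by (simp add: power_mult_distrib power_divide del: of_real_diff)
  have cancel: "X * k\<^sup>2 / (a\<^sup>2 * b\<^sup>2) / ((k * p / a\<^sup>2) * (k * q / b\<^sup>2)) = X / (p * q)"
    if "k \<noteq> 0" "a \<noteq> 0" "b \<noteq> 0" for X k p q a b :: real
    using that by (simp add: power2_eq_square)
  have "(cmod (Moebius_function 0 c z - Moebius_function 0 c w))\<^sup>2 /
      ((1 - (cmod (Moebius_function 0 c z))\<^sup>2) * (1 - (cmod (Moebius_function 0 c w))\<^sup>2)) =
      (cmod (z - w))\<^sup>2 / ((1 - (cmod z)\<^sup>2) * (1 - (cmod w)\<^sup>2))"
    unfolding dist one_minus_cmod_Moebius[OF assms(1,2)] one_minus_cmod_Moebius[OF assms(1,3)]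
    using cancel[of "1 - (cmod c)\<^sup>2" "cmod (1 - cnj c * z)" "cmod (1 - cnj c * w)"]
      Moebius_denominator_nonzero[OF assms(1,2)] Moebius_denominator_nonzero[OF assms(1,3)]
      one_minus_cmod_power2_pos[OF assms(1)]
    by (simp only: norm_eq_zero less_imp_neq[THEN not_sym] not_False_eq_True)
  then show ?thesis
    unfolding hdist_def times_divide_eq_right[symmetric] by (simp only:)
qed

lemma Moebius_in_hyp_plane:
  "c \<in> hyp_plane \<Longrightarrow> z \<in> hyp_plane \<Longrightarrow> Moebius_function 0 c z \<in> hyp_plane"
  by (simp add: hyp_plane_iff Moebius_function_norm_lt_1)

lemma hyp_isometry_Moebius:
  assumes "c \<in> hyp_plane"
  shows "hyp_isometry (Moebius_function 0 c)"
  unfolding hyp_isometry_def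
proof
  show "bij_betw (Moebius_function 0 c) hyp_plane hyp_plane"
    using assms
    \<comment> \<open>The inverse of the map taking \<open>c\<close> to 0 is the map of the same
      kind with center \<open>-c\<close>.\<close>
    by (intro bij_betw_byWitness[where f' = "Moebius_function 0 (-c)"])
      (auto simp: hyp_plane_iff Moebius_function_compose Moebius_function_norm_lt_1)
qed (use assms hdist_Moebius in auto)

lemma hyp_isometry_rotation:
  assumes "cmod u = 1"
  shows "hyp_isometry (\<lambda>z. u * z)"
proof -
  have "u * cnj u = 1"
    using assms by (simp add: complex_norm_square[symmetric])
  then have "cnj u * (u * z) = z" "u * (cnj u * z) = z" for z
    by (metis mult.assoc mult.commute mult_1)+
  moreover have "(\<lambda>z. v * z) ` hyp_plane \<subseteq> hyp_plane" if "cmod v = 1" for v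
    using that by (auto simp: hyp_plane_iff norm_mult)
  ultimately have "bij_betw (\<lambda>z. u * z) hyp_plane hyp_plane"
    using assms by (intro bij_betw_byWitness[where f' = "\<lambda>z. cnj u * z"]) auto
  moreover have "hdist (u * z) (u * w) = hdist z w" for z w
  proof -
    have "cmod (u * z - u * w) = cmod (z - w)"
      unfolding right_diff_distrib[symmetric] norm_mult assms by simp
    then show ?thesis
      unfolding hdist_def by (simp only: norm_mult assms mult_1)
  qed
  ultimately show ?thesis
    by (simp add: hyp_isometry_def)
qed

lemma hyp_isometry_id: "hyp_isometry id"
  by (simp add: hyp_isometry_def)

lemma hyp_isometry_in_hyp_plane: "hyp_isometry f \<Longrightarrow> z \<in> hyp_plane \<Longrightarrow> f z \<in> hyp_plane"
  unfolding hyp_isometry_def by (meson bij_betwE)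

lemma hyp_isometry_comp:
  assumes "hyp_isometry f" "hyp_isometry g"
  shows "hyp_isometry (f \<circ> g)"
  using assms hyp_isometry_in_hyp_plane[OF assms(2)]
  unfolding hyp_isometry_def by (auto intro: bij_betw_trans)

lemma hyp_isometry_inv:
  assumes "hyp_isometry f"
  shows "hyp_isometry (inv_into hyp_plane f)"
proof -
  have f: "bij_betw f hyp_plane hyp_plane"
    using assms by (simp add: hyp_isometry_def)
  have b: "bij_betw (inv_into hyp_plane f) hyp_plane hyp_plane"
    using f by (rule bij_betw_inv_into)
  moreover have "hdist (inv_into hyp_plane f z) (inv_into hyp_plane f w) = hdist z w"
    if "z \<in> hyp_plane" "w \<in> hyp_plane" for z w
  proof -
    have "inv_into hyp_plane f z \<in> hyp_plane" "inv_into hyp_plane f w \<in> hyp_plane"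
      using b that by (auto dest: bij_betwE)
    then have "hdist (f (inv_into hyp_plane f z)) (f (inv_into hyp_plane f w)) =
        hdist (inv_into hyp_plane f z) (inv_into hyp_plane f w)"
      using assms by (simp add: hyp_isometry_def)
    then show ?thesis
      using bij_betw_inv_into_right[OF f] that by simp
  qed
  ultimately show ?thesis
    by (simp add: hyp_isometry_def)
qed

lemma hyp_isometry_inv_f:
  assumes "hyp_isometry f" "z \<in> hyp_plane"
  shows "inv_into hyp_plane f (f z) = z"
  using assms by (meson bij_betw_inv_into_left hyp_isometry_def)

section \<open>Circles, central angles and chords\<close>

text \<open>After moving \<open>c\<close> to 0, a point at Euclidean radius r and hyperbolic
  distance h from 0 satisfies sinh(h/2)^2 = r^2 / (1 - r^2), that is, tanh(h/2) = r. Hyperbolic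
  circles thus become Euclidean circles around 0.\<close>

lemma mem_hcircle_iff:
  assumes "c \<in> hyp_plane" "J > 0"
  shows "z \<in> hcircle c J \<longleftrightarrow> z \<in> hyp_plane \<and> cmod (Moebius_function 0 c z) = tanh (J / 2)"
proof (cases "z \<in> hyp_plane")
  case True
  define r where "r = cmod (Moebius_function 0 c z)"
  have r: "0 < 1 - r\<^sup>2" "0 \<le> r"
    unfolding r_def using one_minus_cmod_power2_pos Moebius_in_hyp_plane assms(1) True by auto
  have "0 \<in> hyp_plane"
    by (simp add: hyp_plane_iff)
  have d: "hdist c z = hdist 0 (Moebius_function 0 c z)"
    using hdist_Moebius[of c c z] assms(1) True by (simp add: Moebius_function_eq_zero)
  have s: "(sinh (hdist c z / 2))\<^sup>2 = r\<^sup>2 / (1 - r\<^sup>2)"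
    using sinh_half_hdist[of 0 "Moebius_function 0 c z"] assms True \<open>0 \<in> hyp_plane\<close>
    unfolding d by (simp add: Moebius_in_hyp_plane r_def)
  have "(tanh (hdist c z / 2))\<^sup>2 = r\<^sup>2"
    unfolding tanh_def power_divide cosh_square_eq s using r by (simp add: field_simps)
  moreover have "0 \<le> tanh (hdist c z / 2)"
    using hdist_nonneg assms(1) True by simp
  ultimately have "tanh (hdist c z / 2) = r"
    using r(2) by (simp add: power2_eq_iff_nonneg)
  then have "hdist c z = J \<longleftrightarrow> r = tanh (J / 2)"
    by auto
  then show ?thesis
    using True by (simp add: hcircle_def r_def)
qed (simp add: hcircle_def)

lemma Arg2pi_polar:
  assumes "cmod u = cmod v" "u \<noteq> 0"
  shows "v = u * cis (Arg2pi (v / u))"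
proof -
  have "cmod (v / u) = 1"
    using assms by (auto simp: norm_divide)
  then have "cis (Arg2pi (v / u)) = v / u"
    by (simp add: complex_norm_eq_1_exp cis_conv_exp)
  then show ?thesis
    using assms(2) by simp
qed

lemma Arg2pi_cis:
  assumes "u \<noteq> 0" "v = u * cis a" "0 \<le> a" "a < 2 * pi"
  shows "Arg2pi (v / u) = a"
  using assms by (intro Arg2pi_unique[of 1]) (auto simp: cis_conv_exp)

lemma hangle_bounds: "0 \<le> hangle c z w" "hangle c z w < 2 * pi"
  by (auto simp: hangle_def Arg2pi)

text \<open>Both images lie on one Euclidean circle around 0, so they differ by a rotation. This
  turns arguments about arcs into addition of angles.\<close>

lemma Moebius_hangle:
  assumes "c \<in> hyp_plane" "J > 0" "z \<in> hcircle c J" "w \<in> hcircle c J"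
  shows "Moebius_function 0 c w = Moebius_function 0 c z * cis (hangle c z w)"
proof -
  have "cmod (Moebius_function 0 c z) = cmod (Moebius_function 0 c w)" "Moebius_function 0 c z \<noteq> 0"
    using assms by (auto simp: mem_hcircle_iff)
  then show ?thesis
    unfolding hangle_def by (rule Arg2pi_polar)
qed

text \<open>Moving the center to 0 gives a Euclidean chord of length 2r sin(a/2) with r = tanh(J/2),
  while both endpoints contribute the factor 1 - r^2 to the distance formula; finally 2r / (1 - r^2)
  = sinh J.\<close>

lemma sinh_half_chord:
  assumes "c \<in> hyp_plane" "J > 0" "z \<in> hcircle c J" "w \<in> hcircle c J"
  shows "sinh (hdist z w / 2) = sinh J * sin (hangle c z w / 2)"
proof -
  let ?M = "Moebius_function 0 c" and ?a = "hangle c z w"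
  define r where "r = tanh (J / 2)"
  have zw: "z \<in> hyp_plane" "w \<in> hyp_plane" and r: "cmod (?M z) = r" "cmod (?M w) = r"
    using assms by (auto simp: mem_hcircle_iff r_def)
  have "?M z - ?M w = - (?M z * (cis ?a - 1))"
    using Moebius_hangle[OF assms] by (simp add: algebra_simps)
  then have "cmod (?M z - ?M w) = r * (2 * \<bar>sin (?a / 2)\<bar>)"
    by (simp only: norm_minus_cancel norm_mult r cis_conv_exp dist_exp_i_1)
  then have "(cmod (?M z - ?M w))\<^sup>2 = 4 * r\<^sup>2 * (sin (?a / 2))\<^sup>2"
    by (simp add: power_mult_distrib)
  then have "(sinh (hdist z w / 2))\<^sup>2 = 4 * r\<^sup>2 / (1 - r\<^sup>2)\<^sup>2 * (sin (?a / 2))\<^sup>2"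
    using sinh_half_hdist[of "?M z" "?M w"] zw assms(1)
    by (simp add: hdist_Moebius Moebius_in_hyp_plane r power2_eq_square)
  moreover have "sinh J = 2 * r / (1 - r\<^sup>2)"
  proof -
    have "1 - r\<^sup>2 = 1 / (cosh (J / 2))\<^sup>2"
      unfolding r_def tanh_def power_divide by (simp add: sinh_square_eq field_simps)
    then show ?thesis
      using sinh_double[of "J / 2"] by (simp add: r_def tanh_def power2_eq_square)
  qed
  ultimately have "(sinh (hdist z w / 2))\<^sup>2 = (sinh J * sin (?a / 2))\<^sup>2"
    by (simp add: power_mult_distrib power_divide)
  moreover have "0 \<le> sinh (hdist z w / 2)"
    using hdist_nonneg zw by simp
  moreover have "0 \<le> sinh J * sin (?a / 2)"
    using hangle_bounds[of c z w] assms(2) by (auto intro!: mult_nonneg_nonneg sin_ge_zero)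
  ultimately show ?thesis
    by (rule power2_eq_imp_eq)
qed

section \<open>The function \<open>theta\<close> and its dependence on the radius\<close>

text \<open>\<open>arcsin\<close> inverts the sine only up to pi / 2, so an angle beyond
  \<open>pi\<close> is returned reflected.\<close>

lemma theta_eq_angle:
  assumes "0 < J" "0 \<le> a" "a \<le> 2 * pi" "sinh (d / 2) = sinh J * sin (a / 2)"
  shows "theta d J = (if a \<le> pi then a else 2 * pi - a)"
proof -
  have "theta d J = 2 * arcsin (sin (a / 2))"
    using assms(1,4) by (simp add: theta_def)
  also have "arcsin (sin (a / 2)) = (if a \<le> pi then a / 2 else pi - a / 2)"
  proof (cases "a \<le> pi")
    case True
    then show ?thesis
      using assms(2) by (simp add: arcsin_sin)
  next
    case False
    then have "arcsin (sin (pi - a / 2)) = pi - a / 2"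
      using assms(3) by (intro arcsin_sin) auto
    then show ?thesis
      using False by simp
  qed
  finally show ?thesis
    by (simp split: if_splits)
qed

text \<open>Keeps the argument of \<open>arcsin\<close> in the range where \<open>arcsin\<close> is
  strictly increasing and a right inverse of the sine.\<close>

lemma theta_arg_bounds:
  fixes d J :: real
  assumes "0 < d" "d / 2 \<le> J"
  shows "0 < sinh (d / 2) / sinh J" "sinh (d / 2) / sinh J \<le> 1"
proof -
  have "0 < sinh (d / 2)" "sinh (d / 2) \<le> sinh J"
    using assms by (simp_all only: sinh_real_le_iff sinh_real_pos_iff half_gt_zero)
  then show "0 < sinh (d / 2) / sinh J" "sinh (d / 2) / sinh J \<le> 1"
    by simp_all
qed

lemma theta_pos: "0 < d \<Longrightarrow> d / 2 \<le> J \<Longrightarrow> 0 < theta d J"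
  using arcsin_less_arcsin[of 0 "sinh (d / 2) / sinh J"] theta_arg_bounds[of d J]
  by (simp add: theta_def)

text \<open>A side that is a diameter subtends half a turn.\<close>

lemma theta_self: "0 < J \<Longrightarrow> theta (2 * J) J = pi"
  by (simp add: theta_def)

lemma sin_half_theta:
  assumes "0 < d" "d / 2 \<le> J"
  shows "sinh J * sin (theta d J / 2) = sinh (d / 2)"
proof -
  have "sin (arcsin (sinh (d / 2) / sinh J)) = sinh (d / 2) / sinh J"
    using theta_arg_bounds[OF assms] by (intro sin_arcsin) linarith+
  then show ?thesis
    using assms by (simp add: theta_def)
qed

lemma theta_strict_antimono:
  assumes "0 < d" "d / 2 \<le> J" "J < J'"
  shows "theta d J' < theta d J"
proof -
  have "sinh (d / 2) / sinh J' < sinh (d / 2) / sinh J"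
    using assms by (intro divide_strict_left_mono mult_pos_pos) auto
  then have "arcsin (sinh (d / 2) / sinh J') < arcsin (sinh (d / 2) / sinh J)"
    using theta_arg_bounds[of d J] theta_arg_bounds[of d J'] assms
    by (intro arcsin_less_arcsin) linarith+
  then show ?thesis
    by (simp add: theta_def)
qed

lemma sum_theta_strict_antimono:
  assumes "finite I" "I \<noteq> {}" "\<And>i. i \<in> I \<Longrightarrow> 0 < d i \<and> d i / 2 \<le> J" "J < J'"
  shows "(\<Sum>i\<in>I. theta (d i) J') < (\<Sum>i\<in>I. theta (d i) J)"
  using assms by (intro sum_strict_mono theta_strict_antimono) auto

text \<open>In the variable \<open>1 / sinh J\<close> the angle sum extends continuously to radius infinity,
  where it vanishes.\<close>

lemma exists_radius_sum_theta_eq: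
  assumes "finite I" "0 < m" "\<And>i. i \<in> I \<Longrightarrow> 0 < d i \<and> d i / 2 \<le> m"
    and "0 < S" "S < (\<Sum>i\<in>I. theta (d i) m)"
  shows "\<exists>J>m. (\<Sum>i\<in>I. theta (d i) J) = S"
proof -
  define f where "f t = (\<Sum>i\<in>I. 2 * arcsin (sinh (d i / 2) * t))" for t
  have f: "f (1 / sinh J) = (\<Sum>i\<in>I. theta (d i) J)" for J
    by (simp add: f_def theta_def)
  have pos: "0 < sinh m"
    using assms(2) by simp
  have "continuous_on {0..1 / sinh m} f"
    unfolding f_def
  proof (intro continuous_intros ballI conjI)
    fix i t assume it: "i \<in> I" "t \<in> {0..1 / sinh m}"
    then have "0 < sinh (d i / 2)"
      using assms(3) by simp
    moreover have "0 \<le> t"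
      using it by simp
    ultimately have "0 \<le> sinh (d i / 2) * t"
      by simp
    then show "- 1 \<le> sinh (d i / 2) * t"
      by linarith
    have "sinh (d i / 2) * t \<le> sinh m * (1 / sinh m)"
      using it assms(3) \<open>0 < sinh (d i / 2)\<close> pos by (intro mult_mono) auto
    then show "sinh (d i / 2) * t \<le> 1"
      using pos by simp
  qed
  moreover have "f 0 = 0"
    by (simp add: f_def)
  ultimately obtain t where t: "0 \<le> t" "t \<le> 1 / sinh m" "f t = S"
    using IVT'[of f 0 S "1 / sinh m"] assms(4,5) pos by (auto simp: f)
  have "t \<noteq> 0" "t \<noteq> 1 / sinh m"
    using t \<open>f 0 = 0\<close> assms(4,5) f[of m] by auto
  then have "0 < t" "t < 1 / sinh m"
    using t by auto
  define J where "J = arsinh (1 / t)"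
  have "sinh m < sinh J"
    using \<open>0 < t\<close> \<open>t < 1 / sinh m\<close> pos by (simp add: J_def field_simps)
  then have "m < J"
    by simp
  moreover have "(\<Sum>i\<in>I. theta (d i) J) = S"
    using f[of J] t(3) by (simp add: J_def)
  ultimately show ?thesis
    by blast
qed

section \<open>Concavity of the sine and the inequalities defining \<open>AC\<close>\<close>

text \<open>Strict concavity: the chord slopes of \<open>sin\<close> on the two sides of \<open>t\<close> are values of \<open>cos\<close>
  at points separated by \<open>t\<close>.\<close>

lemma sin_gt_chord:
  assumes "0 < t" "t < pi / 2"
  shows "2 / pi * t < sin t"
proof (rule ccontr)
  assume "\<not> 2 / pi * t < sin t"
  then have le: "sin t \<le> 2 / pi * t"
    by simp
  obtain y where y: "0 < y" "y < t" "sin t - sin 0 = (t - 0) * cos y"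
    using MVT2[of 0 t sin cos] assms by (auto intro: DERIV_sin)
  obtain z where z: "t < z" "z < pi / 2" "sin (pi / 2) - sin t = (pi / 2 - t) * cos z"
    using MVT2[of t "pi / 2" sin cos] assms by (auto intro: DERIV_sin)
  have "t * cos y \<le> t * (2 / pi)"
    using le y by (simp add: mult.commute)
  then have "cos y \<le> 2 / pi"
    using assms(1) by (simp only: mult_le_cancel_left_pos)
  have "(pi / 2 - t) * (2 / pi) = 1 - 2 / pi * t"
    by (simp add: field_simps)
  also have "\<dots> \<le> (pi / 2 - t) * cos z"
    using le z(3) by simp
  finally have "2 / pi \<le> cos z"
    using assms(2) by (simp only: mult_le_cancel_left_pos diff_gt_0_iff_gt)
  moreover have "cos z < cos y"
    using y z by (intro cos_monotone_0_pi) auto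
  ultimately show False
    using \<open>cos y \<le> 2 / pi\<close> by linarith
qed

lemma arcsin_less_linear:
  assumes "0 < s" "s < 1"
  shows "arcsin s < pi / 2 * s"
proof -
  have "0 < arcsin s" "arcsin s < pi / 2"
    using assms arcsin_less_arcsin[of 0 s] arcsin_less_arcsin[of s 1] by auto
  then have "2 / pi * arcsin s < s"
    using sin_gt_chord[of "arcsin s"] assms by simp
  then show ?thesis
    by (simp add: field_simps)
qed

text \<open>By concavity each \<open>arcsin (s i)\<close> is at most pi / 2 times
  \<open>s i\<close>, strictly when \<open>s i < 1\<close>; one strict summand suffices. If every
  \<open>s i\<close> equals 1, the sum is the number of summands, which is at least 2.\<close>

lemma sum_gt_1_if_sum_arcsin_ge:
  assumes "finite I" "2 \<le> card I" "\<And>i. i \<in> I \<Longrightarrow> 0 < s i \<and> s i \<le> 1"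
    and "pi / 2 \<le> (\<Sum>i\<in>I. arcsin (s i))"
  shows "1 < (\<Sum>i\<in>I. s i)"
proof (cases "\<exists>i\<in>I. s i < 1")
  case True
  have "arcsin (s i) \<le> pi / 2 * s i" if "i \<in> I" for i
    using arcsin_less_linear[of "s i"] assms(3)[OF that] by (cases "s i = 1") auto
  then have "(\<Sum>i\<in>I. arcsin (s i)) < (\<Sum>i\<in>I. pi / 2 * s i)"
    using True assms(3) arcsin_less_linear by (intro sum_strict_mono_ex1 assms(1)) blast+
  then have "pi / 2 * 1 < pi / 2 * (\<Sum>i\<in>I. s i)"
    using assms(4) by (simp add: sum_distrib_left)
  then show ?thesis
    by simp
next
  case False
  then have "(\<Sum>i\<in>I. s i) = (\<Sum>i\<in>I. 1)"
    using assms(3) by (intro sum.cong) (auto simp: not_less antisym)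
  then show ?thesis
    using assms(2) by simp
qed

lemma obtain_max_index:
  fixes d :: "nat \<Rightarrow> real"
  assumes "0 < n"
  obtains i0 where "i0 < n" "Max (d ` {..<n}) = d i0" "\<And>i. i < n \<Longrightarrow> d i \<le> d i0"
proof -
  have "Max (d ` {..<n}) \<in> d ` {..<n}"
    using assms by (intro Max_in) auto
  then obtain i0 where "i0 < n" "Max (d ` {..<n}) = d i0"
    by auto
  then show thesis
    using that Max_ge[of "d ` {..<n}"] by auto
qed

text \<open>Used to split off one more side, whose positive length or angle makes an inequality
  strict.\<close>

lemma obtain_third_index:
  fixes i j n :: nat
  assumes "3 \<le> n"
  obtains k where "k < n" "k \<noteq> i" "k \<noteq> j"
proof -
  have "\<exists>k<3. k \<noteq> i \<and> k \<noteq> j"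
    by presburger
  then show thesis
    using assms that by (meson less_le_trans)
qed

text \<open>At radius half the longest side, that side contributes \<open>pi\<close>, so the others
  contribute at least \<open>pi\<close>; the concavity estimate converts this angle bound into the
  bound on sinh. For any other side, the longest side together with a third one already exceeds it.
  The weak inequality in the hypothesis covers both \<open>CC\<close> and \<open>BC\<close>.\<close>

lemma sum_theta_ge_imp_AC:
  assumes "3 \<le> n" "d \<in> {..<n} \<rightarrow>\<^sub>E {0<..}"
    and "2 * pi \<le> (\<Sum>i<n. theta (d i) (Max (d ` {..<n}) / 2))"
  shows "d \<in> AC n"
proof -
  have pos: "0 < d i" if "i < n" for i
    using assms(2) that by (auto simp: PiE_iff)
  obtain i0 where i0: "i0 < n" "Max (d ` {..<n}) = d i0" "\<And>i. i < n \<Longrightarrow> d i \<le> d i0"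
    using obtain_max_index[of n d] assms(1) by auto
  have "sinh (d i / 2) < (\<Sum>j\<in>{..<n} - {i}. sinh (d j / 2))" if "i < n" for i
  proof (cases "i = i0")
    case True
    define s where "s j = sinh (d j / 2) / sinh (d i0 / 2)" for j
    have "(\<Sum>j<n. theta (d j) (d i0 / 2)) =
        theta (d i0) (d i0 / 2) + (\<Sum>j\<in>{..<n} - {i0}. theta (d j) (d i0 / 2))"
      using i0(1) by (intro sum.remove) auto
    then have "pi \<le> (\<Sum>j\<in>{..<n} - {i0}. theta (d j) (d i0 / 2))"
      using assms(3) theta_self[of "d i0 / 2"] pos[OF i0(1)] i0(2) by simp
    also have "\<dots> = 2 * (\<Sum>j\<in>{..<n} - {i0}. arcsin (s j))"
      by (simp add: theta_def s_def sum_distrib_left)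
    finally have "pi / 2 \<le> (\<Sum>j\<in>{..<n} - {i0}. arcsin (s j))"
      by simp
    moreover have "0 < s j \<and> s j \<le> 1" if "j \<in> {..<n} - {i0}" for j
      using that pos i0 theta_arg_bounds[of "d j" "d i0 / 2"] unfolding s_def by auto
    ultimately have "1 < (\<Sum>j\<in>{..<n} - {i0}. s j)"
      using assms(1) i0(1) by (intro sum_gt_1_if_sum_arcsin_ge) auto
    then show ?thesis
      using pos[OF i0(1)] True by (simp add: s_def sum_divide_distrib[symmetric])
  next
    case False
    obtain k where k: "k < n" "k \<noteq> i" "k \<noteq> i0"
      using obtain_third_index assms(1) .
    have "sinh (d i / 2) < sinh (d i0 / 2) + sinh (d k / 2)"
      using add_le_less_mono[of "sinh (d i / 2)" "sinh (d i0 / 2)" 0 "sinh (d k / 2)"]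
      i0(3)[OF that] pos[OF k(1)] by simp
    also have "\<dots> = (\<Sum>j\<in>{i0, k}. sinh (d j / 2))"
      using k by simp
    also have "\<dots> \<le> (\<Sum>j\<in>{..<n} - {i}. sinh (d j / 2))"
      using k i0(1) False pos by (intro sum_mono2) (auto intro: less_imp_le)
    finally show ?thesis .
  qed
  then show ?thesis
    using assms(2) by (simp add: AC_def)
qed

section \<open>Relations between angles and side lengths, without points\<close>

text \<open>Separates the arithmetic of central angles from the geometry. It is instantiated in two
  ways: with the measured angles of a given polygon, and with values of \<open>theta\<close> when a
  polygon is to be built.\<close>

locale cyclic_angles =
  fixes n :: nat and J :: real and a d :: "nat \<Rightarrow> real"
  assumes n_ge_3: "3 \<le> n"
    and J_pos: "0 < J"
    and angle_pos: "i < n \<Longrightarrow> 0 < a i"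
    and sum_angles: "(\<Sum>i<n. a i) = 2 * pi"
    and side: "i < n \<Longrightarrow> sinh (d i / 2) = sinh J * sin (a i / 2)"
begin

lemma sum_angles_le:
  assumes "I \<subseteq> {..<n}"
  shows "(\<Sum>i\<in>I. a i) \<le> 2 * pi"
  unfolding sum_angles[symmetric]
  using assms angle_pos by (intro sum_mono2) (auto simp: less_eq_real_def)

lemma angle_lt_2pi:
  assumes "i < n"
  shows "a i < 2 * pi"
proof -
  obtain j where "j < n" "j \<noteq> i"
    using obtain_third_index n_ge_3 .
  then show ?thesis
    using sum_angles_le[of "{i, j}"] angle_pos[of j] assms by auto
qed

text \<open>No chord is longer than a diameter, because the sine is at most 1.\<close>

lemma radius_ge:
  assumes "i < n"
  shows "d i / 2 \<le> J"
proof -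
  have "sinh J * sin (a i / 2) \<le> sinh J * 1"
    using J_pos by (intro mult_left_mono) auto
  then have "sinh (d i / 2) \<le> sinh J"
    unfolding side[OF assms] by (simp only: mult_1_right)
  then show ?thesis
    by (simp only: sinh_real_le_iff)
qed

lemma side_pos:
  assumes "i < n"
  shows "0 < d i"
proof -
  have "0 < sinh (d i / 2)"
    unfolding side[OF assms]
    using angle_pos[OF assms] angle_lt_2pi[OF assms] J_pos
    by (intro mult_pos_pos sin_gt_zero) auto
  then show ?thesis
    by simp
qed

lemma theta_eq:
  assumes "i < n" "a i \<le> pi"
  shows "theta (d i) J = a i"
  using theta_eq_angle[OF J_pos _ _ side[OF assms(1)]] angle_pos[OF assms(1)] assms(2) by simp

text \<open>If a side subtends an angle of at least \<open>\<pi>\<close>, then the angle left over is at most \<open>\<pi>\<close> and is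
  split among at least two other sides, so that side is the unique longest one.\<close>

lemma angle_lt_pi_if_not_max:
  assumes "i < n" "k < n" "i \<noteq> k" "d i \<le> d k"
  shows "a i < pi"
proof (rule ccontr)
  assume "\<not> a i < pi"
  obtain j where j: "j < n" "j \<noteq> i" "j \<noteq> k"
    using obtain_third_index n_ge_3 .
  then have "a k < 2 * pi - a i"
    using sum_angles_le[of "{i, j, k}"] angle_pos[of j] assms by auto
  then have "sin (a k / 2) < sin (pi - a i / 2)"
    using angle_pos[of k] \<open>k < n\<close> \<open>\<not> a i < pi\<close> by (intro sin_monotone_2pi) auto
  then have "sinh (d k / 2) < sinh (d i / 2)"
    using J_pos assms side by simp
  then show False
    using assms(4) by simp
qed

context
  fixes i0
  assumes i0: "i0 < n" and max: "\<And>i. i < n \<Longrightarrow> d i \<le> d i0"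
begin

text \<open>All sides other than \<open>i0\<close> subtend less than \<open>pi\<close>, so there
  \<open>theta\<close> is the true angle. Leaving out \<open>i0\<close> avoids the one side where
  \<open>theta\<close> could be the reflected angle, so the formula holds whether or not
  \<open>a i0\<close> exceeds \<open>pi\<close>.\<close>

lemma sum_theta_not_max: "(\<Sum>i\<in>{..<n} - {i0}. theta (d i) J) = 2 * pi - a i0"
proof -
  have "(\<Sum>i\<in>{..<n} - {i0}. theta (d i) J) = (\<Sum>i\<in>{..<n} - {i0}. a i)"
    using i0 max angle_lt_pi_if_not_max by (intro sum.cong theta_eq) (auto intro: less_imp_le)
  also have "\<dots> = 2 * pi - a i0"
    using sum_angles i0 by (simp add: sum_diff1)
  finally show ?thesis .
qed

lemma all_angles_lt_pi_iff: "(\<forall>i<n. a i < pi) \<longleftrightarrow> a i0 < pi"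
  using i0 max angle_lt_pi_if_not_max by metis

text \<open>The chord formula makes the equality of lengths equivalent to sin(a/2) = 1 for the angle
  a of \<open>i0\<close>, and for 0 < a < 2 pi this happens only at a = pi.\<close>

lemma radius_eq_iff: "J = d i0 / 2 \<longleftrightarrow> a i0 = pi"
proof
  assume "J = d i0 / 2"
  then have "sinh J * 1 = sinh J * sin (a i0 / 2)"
    using side[OF i0] by (simp only: mult_1_right)
  then have "sin (a i0 / 2) = sin (pi / 2)"
    unfolding mult_cancel_left using J_pos by simp
  moreover have "sin (a i0 / 2) \<noteq> sin (pi / 2)" if "a i0 < pi"
    using sin_monotone_2pi[of "a i0 / 2" "pi / 2"] that angle_pos[OF i0] by simp
  \<comment> \<open>Beyond \<open>pi\<close> the half-angle leaves the interval on which the sine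
    increases; reflecting it at pi / 2 brings it back.\<close>
  moreover have "sin (pi - a i0 / 2) \<noteq> sin (pi / 2)" if "pi < a i0"
    using sin_monotone_2pi[of "pi - a i0 / 2" "pi / 2"] that angle_lt_2pi[OF i0] by simp
  ultimately show "a i0 = pi"
    using sin_pi_minus[of "a i0 / 2"] by (metis linorder_neqE_linordered_idom)
next
  assume "a i0 = pi"
  then have "sinh (d i0 / 2) = sinh J"
    using side[OF i0] by simp
  then show "J = d i0 / 2"
    by simp
qed

end

lemma sum_theta:
  assumes "\<And>i. i < n \<Longrightarrow> a i \<le> pi"
  shows "(\<Sum>i<n. theta (d i) J) = 2 * pi"
  unfolding sum_angles[symmetric] using assms by (intro sum.cong theta_eq) auto

end

section \<open>Angle sums of cyclic polygons\<close>

text \<open>Uniqueness of the polar angle in [0, 2 pi): an angle is computed by exhibiting a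
  rotation and bounding its amount.\<close>

lemma hangle_eqI:
  assumes "c \<in> hyp_plane" "J > 0" "z \<in> hcircle c J"
    and "Moebius_function 0 c w = Moebius_function 0 c z * cis b" "0 \<le> b" "b < 2 * pi"
  shows "hangle c z w = b"
proof -
  have "Moebius_function 0 c z \<noteq> 0"
    using assms by (auto simp: mem_hcircle_iff)
  then show ?thesis
    unfolding hangle_def using assms(4-6) by (rule Arg2pi_cis)
qed

lemma prev_less: "i < n \<Longrightarrow> prev n i < n"
  by (auto simp: prev_def)

lemma side_lengths_apply: "i < n \<Longrightarrow> side_lengths n x i = hdist (x (prev n i)) (x i)"
  by (simp add: side_lengths_def)

lemma cyclic_ngon_vertex:
  "cyclic_ngon n c J x \<Longrightarrow> i < n \<Longrightarrow> x i \<in> hcircle c J"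
  by (auto simp: cyclic_ngon_def)

lemma cyclic_ngon_side_angle:
  assumes "cyclic_ngon n c J x" "i < n"
  shows "sinh (side_lengths n x i / 2) = sinh J * sin (hangle c (x (prev n i)) (x i) / 2)"
  unfolding side_lengths_apply[OF assms(2)]
  using assms cyclic_ngon_vertex[OF assms(1)] prev_less
  by (intro sinh_half_chord[of c J]) (auto simp: cyclic_ngon_def)

text \<open>By the chord formula a zero angle would give a side of length zero.\<close>

lemma cyclic_ngon_angle_pos:
  assumes "cyclic_ngon n c J x" "i < n"
  shows "0 < hangle c (x (prev n i)) (x i)"
proof -
  have "0 < side_lengths n x i"
    using assms by (auto simp: cyclic_ngon_def)
  then have "hangle c (x (prev n i)) (x i) \<noteq> 0"
    using cyclic_ngon_side_angle[OF assms] by auto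
  then show ?thesis
    using hangle_bounds(1)[of c "x (prev n i)" "x i"] by linarith
qed

text \<open>Angles add along the polygon as long as the total stays below a full turn. The cyclic
  order guarantees this: a step that reached or passed \<open>x 0\<close> would have
  \<open>x 0\<close> on its arc.\<close>

lemma cyclic_ngon_hangle_from_0:
  assumes "cyclic_ngon n c J x" "i < n"
  shows "hangle c (x 0) (x i) = (\<Sum>k\<in>{1..i}. hangle c (x (prev n k)) (x k))"
  using assms(2)
proof (induction i)
  case 0
  have "Moebius_function 0 c (x 0) = Moebius_function 0 c (x 0) * cis 0"
    by simp
  then show ?case
    using assms(1) 0 cyclic_ngon_vertex[OF assms(1) 0] by (auto simp: cyclic_ngon_def intro: hangle_eqI)
next
  case (Suc i)
  let ?M = "Moebius_function 0 c"
  define s where "s = hangle c (x 0) (x i)"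
  define a where "a = hangle c (x i) (x (Suc i))"
  have C: "c \<in> hyp_plane" "J > 0"
    using assms(1) by (auto simp: cyclic_ngon_def)
  have v: "x 0 \<in> hcircle c J" "x i \<in> hcircle c J" "x (Suc i) \<in> hcircle c J"
    using Suc.prems cyclic_ngon_vertex[OF assms(1)] by auto
  have s: "?M (x i) = ?M (x 0) * cis s" "0 \<le> s" "s < 2 * pi"
    unfolding s_def by (intro Moebius_hangle[OF C] v hangle_bounds)+
  have a: "?M (x (Suc i)) = ?M (x i) * cis a" "0 \<le> a" "a < 2 * pi"
    unfolding a_def by (intro Moebius_hangle[OF C] v hangle_bounds)+
  have "s + a < 2 * pi"
  proof (rule ccontr)
    assume *: "\<not> s + a < 2 * pi"
    then have "0 < s"
      using a(3) by simp
    have "?M (x 0) = ?M (x i) * cis (2 * pi - s)"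
      unfolding s(1) by (simp add: mult.assoc cis_mult)
    \<comment> \<open>Going on from \<open>x i\<close>, the marked vertex is reached after the rest
      of the turn, which is at most \<open>a\<close> under the assumption \<open>*\<close>. Hence
      \<open>x 0\<close> lies on the arc to \<open>x (Suc i)\<close>.\<close>
    then have h: "hangle c (x i) (x 0) = 2 * pi - s"
      using \<open>0 < s\<close> s(3) by (intro hangle_eqI[OF C v(2)]) auto
    then have "x 0 \<in> ccw_arc c J (x i) (x (Suc i))"
      using * v(1) by (simp add: ccw_arc_def a_def[symmetric])
    moreover have "x 0 \<noteq> x i"
    proof
      assume "x 0 = x i"
      then have "hangle c (x 0) (x i) = 0"
        by (intro hangle_eqI[OF C v(1)]) auto
      then show False
        using \<open>0 < s\<close> by (simp add: s_def)
    qed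
    moreover have "x 0 \<notin> ccw_arc c J (x (Suc i - 1)) (x (Suc i)) - {x (Suc i - 1)}"
    proof -
      have "Suc i \<in> {1..<n}" "0 \<in> {..<n} - {Suc i}"
        using Suc.prems by auto
      then show ?thesis
        using assms(1) unfolding cyclic_ngon_def by blast
    qed
    ultimately show False
      by simp
  qed
  moreover have "?M (x (Suc i)) = ?M (x 0) * cis (s + a)"
    unfolding a(1) s(1) by (simp add: mult.assoc cis_mult)
  ultimately have "hangle c (x 0) (x (Suc i)) = s + a"
    using s(2) a(2) by (intro hangle_eqI[OF C v(1)]) auto
  then show ?case
    using Suc by (simp add: s_def a_def prev_def)
qed

lemma sum_lessThan_eq_first: "(\<Sum>i<n. f i) = f 0 + (\<Sum>i\<in>{1..n - 1}. f i)"
  if "0 < n" for f :: "nat \<Rightarrow> real"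
proof -
  have "{..<n} = insert 0 {1..n - 1}"
    using that by auto
  then show ?thesis
    by simp
qed

text \<open>The sides with index at least 1 lead from \<open>x 0\<close> to \<open>x (n - 1)\<close>
  through an angle \<open>s\<close>; the closing side, which has index 0, subtends the remaining
  \<open>2 * pi - s\<close>.\<close>

lemma cyclic_ngon_sum_angles:
  assumes "cyclic_ngon n c J x" "2 \<le> n"
  shows "(\<Sum>i<n. hangle c (x (prev n i)) (x i)) = 2 * pi"
proof -
  define s where "s = hangle c (x 0) (x (n - 1))"
  have C: "c \<in> hyp_plane" "J > 0"
    using assms(1) by (auto simp: cyclic_ngon_def)
  have v: "x 0 \<in> hcircle c J" "x (n - 1) \<in> hcircle c J"
    using assms(2) cyclic_ngon_vertex[OF assms(1)] by auto
  have sum: "s = (\<Sum>k\<in>{1..n - 1}. hangle c (x (prev n k)) (x k))"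
    unfolding s_def using cyclic_ngon_hangle_from_0[OF assms(1), of "n - 1"] assms(2) by simp
  \<comment> \<open>Ensures \<open>2 * pi - s < 2 * pi\<close>, so that \<open>hangle_eqI\<close>
    applies to the closing side.\<close>
  have "0 < s"
    unfolding sum using assms cyclic_ngon_angle_pos by (intro sum_pos) auto
  have "Moebius_function 0 c (x (n - 1)) = Moebius_function 0 c (x 0) * cis s"
    unfolding s_def by (rule Moebius_hangle[OF C v])
  then have "Moebius_function 0 c (x 0) = Moebius_function 0 c (x (n - 1)) * cis (2 * pi - s)"
    by (simp add: mult.assoc cis_mult)
  then have "hangle c (x (n - 1)) (x 0) = 2 * pi - s"
    using \<open>0 < s\<close> hangle_bounds[of c "x 0" "x (n - 1)"]
    by (intro hangle_eqI[OF C v(2)]) (auto simp: s_def)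
  then show ?thesis
    using sum assms(2) by (simp add: sum_lessThan_eq_first prev_def)
qed

lemma cyclic_ngon_cyclic_angles:
  assumes "cyclic_ngon n c J x" "3 \<le> n"
  shows "cyclic_angles n J (\<lambda>i. hangle c (x (prev n i)) (x i)) (side_lengths n x)"
proof
  show "0 < J"
    using assms(1) by (simp add: cyclic_ngon_def)
  show "(\<Sum>i<n. hangle c (x (prev n i)) (x i)) = 2 * pi"
    using assms by (intro cyclic_ngon_sum_angles) auto
qed (use assms cyclic_ngon_angle_pos cyclic_ngon_side_angle in blast)+

section \<open>Polygons with prescribed angles: existence and congruence\<close>

text \<open>Vertices are placed on the circle around 0 at the partial sums of the angles. The total
  2 pi gives the closing side its angle \<open>a 0\<close>, and the chord formula then gives the
  side lengths.\<close>

lemma (in cyclic_angles) exists_cyclic_ngon: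
  assumes "d \<in> extensional {..<n}"
  shows "\<exists>x. cyclic_ngon n 0 J x \<and> side_lengths n x = d \<and>
    (\<forall>i<n. hangle 0 (x (prev n i)) (x i) = a i)"
proof -
  \<comment> \<open>The sum starts at index 1 because side 0 runs from the last vertex back to
    \<open>x 0\<close>; thus \<open>s 0 = 0\<close>.\<close>
  define s where "s i = (\<Sum>k\<in>{1..i}. a k)" for i
  define x where "x = (\<lambda>i\<in>{..<n}. of_real (tanh (J / 2)) * cis (s i))"
  have total: "a 0 + s (n - 1) = 2 * pi"
    using sum_angles sum_lessThan_eq_first[of n a] n_ge_3 by (simp add: s_def)
  have s_less: "s i < s j" if "i < j" "j < n" for i j
  proof -
    have "s j = s i + (\<Sum>k\<in>{Suc i..j}. a k)"
      unfolding s_def using that sum.ub_add_nat[of 1 i a "j - i"] by simp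
    moreover have "0 < (\<Sum>k\<in>{Suc i..j}. a k)"
      using that angle_pos by (intro sum_pos) auto
    ultimately show ?thesis
      by simp
  qed
  have s_bounds: "0 \<le> s i" "s i < 2 * pi" if "i < n" for i
  proof -
    show "0 \<le> s i"
      unfolding s_def using that angle_pos by (intro sum_nonneg) (auto intro: less_imp_le)
    have "s i \<le> s (n - 1)"
      using s_less[of i "n - 1"] that by (cases "i = n - 1") (auto intro: less_imp_le)
    then show "s i < 2 * pi"
      using total angle_pos[of 0] n_ge_3 by simp
  qed
  have M0: "Moebius_function 0 0 z = z" for z
    by (simp add: Moebius_function_simple)
  have c0: "0 \<in> hyp_plane"
    by (simp add: hyp_plane_iff)
  have xi: "x i = of_real (tanh (J / 2)) * cis (s i)" if "i < n" for i
    using that by (simp add: x_def)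
  have v: "x i \<in> hcircle 0 J" if "i < n" for i
    using that J_pos tanh_real_lt_1[of "J / 2"]
    by (simp add: mem_hcircle_iff[OF c0 J_pos] hyp_plane_iff xi M0 norm_mult)
  \<comment> \<open>Turning counterclockwise to a vertex of smaller index passes the position of
    angle 0, which adds a full turn.\<close>
  have h: "hangle 0 (x i) (x j) = (if i \<le> j then s j - s i else 2 * pi + s j - s i)"
    if "i < n" "j < n" for i j
  proof (rule hangle_eqI[OF c0 J_pos v[OF that(1)]])
    show "Moebius_function 0 0 (x j) =
        Moebius_function 0 0 (x i) * cis (if i \<le> j then s j - s i else 2 * pi + s j - s i)"
      using that
      by (simp add: M0 xi mult.assoc cis_mult) (simp add: cis_mult[symmetric])
    show "0 \<le> (if i \<le> j then s j - s i else 2 * pi + s j - s i)"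
      using s_less[of i j] s_bounds[OF that(1)] s_bounds[OF that(2)] that by (cases "i = j") auto
    show "(if i \<le> j then s j - s i else 2 * pi + s j - s i) < 2 * pi"
      using s_less[of j i] s_bounds[OF that(1)] s_bounds[OF that(2)] that by auto
  qed
  have step: "s i = s (i - 1) + a i" if "0 < i" for i
    using that by (cases i) (auto simp: s_def)
  have angle: "hangle 0 (x (prev n i)) (x i) = a i" if "i < n" for i
  proof (cases "i = 0")
    case True
    then show ?thesis
      using total n_ge_3 h[of "n - 1" 0] by (simp add: prev_def s_def)
  next
    case False
    then show ?thesis
      using that h[of "i - 1" i] step[of i] by (simp add: prev_def)
  qed
  have "side_lengths n x i = d i" if "i < n" for i
  proof -
    have "sinh (hdist (x (prev n i)) (x i) / 2) = sinh (d i / 2)"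
      using sinh_half_chord[OF c0 J_pos v v, of "prev n i" i] that
      by (simp add: prev_less angle side)
    then show ?thesis
      using that by (simp add: side_lengths_apply)
  qed
  then have sl: "side_lengths n x = d"
    using assms by (intro extensionalityI[of _ "{..<n}"]) (auto simp: side_lengths_def)
  have "x j \<notin> ccw_arc 0 J (x (i - 1)) (x i) - {x (i - 1)}"
    if "i \<in> {1..<n}" "j \<in> {..<n} - {i}" for i j
  proof
    assume "x j \<in> ccw_arc 0 J (x (i - 1)) (x i) - {x (i - 1)}"
    then have le: "hangle 0 (x (i - 1)) (x j) \<le> s i - s (i - 1)" and "j \<noteq> i - 1"
      using that h[of "i - 1" i] by (auto simp: ccw_arc_def)
    \<comment> \<open>A later vertex lies strictly beyond the end of the arc. An earlier one is
      reached only after going around past \<open>x 0\<close>, whereas the arc ends at position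
      \<open>s i\<close>, before a full turn.\<close>
    have "i < j \<or> j < i - 1"
      using \<open>j \<noteq> i - 1\<close> that by auto
    then consider "i < j" | "j < i - 1"
      by blast
    then show False
    proof cases
      case 1
      then have "hangle 0 (x (i - 1)) (x j) = s j - s (i - 1)"
        using that h[of "i - 1" j] by auto
      then show False
        using le s_less[of i j] 1 that by auto
    next
      case 2
      then have "hangle 0 (x (i - 1)) (x j) = 2 * pi + s j - s (i - 1)"
        using that h[of "i - 1" j] by auto
      then show False
        using le s_bounds[of i] s_bounds[of j] that
        by auto
    qed
  qed
  then have "cyclic_ngon n 0 J x"
    unfolding cyclic_ngon_def sl using c0 J_pos v assms side_pos by (auto simp: x_def PiE_iff)
  then show ?thesis
    using sl angle by blast
qed

text \<open>The isometry between two polygons with the same radius and angles moves the centers to the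
  origin and rotates the marked vertices into each other.\<close>

lemma cyclic_ngons_isometric:
  assumes x: "cyclic_ngon n c J x" and y: "cyclic_ngon n c' J y" and "0 < n"
    and angles: "\<And>i. i < n \<Longrightarrow> hangle c (x (prev n i)) (x i) = hangle c' (y (prev n i)) (y i)"
  shows "\<exists>f. hyp_isometry f \<and> (\<forall>i<n. f (x i) = y i)"
proof -
  let ?M = "Moebius_function 0 c" and ?N = "Moebius_function 0 c'"
  have C: "c \<in> hyp_plane" "c' \<in> hyp_plane" "J > 0"
    using x y by (auto simp: cyclic_ngon_def)
  have v: "x i \<in> hcircle c J" "y i \<in> hcircle c' J" if "i < n" for i
    using that x y by (auto intro: cyclic_ngon_vertex)
  define u where "u = ?N (y 0) / ?M (x 0)"
  have "cmod u = 1" and M0: "?M (x 0) \<noteq> 0"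
    using v[OF \<open>0 < n\<close>] C by (auto simp: mem_hcircle_iff u_def norm_divide)
  define f where "f = inv_into hyp_plane ?N \<circ> ((\<lambda>z. u * z) \<circ> ?M)"
  have "hyp_isometry f"
    unfolding f_def using \<open>cmod u = 1\<close> C
    by (intro hyp_isometry_comp hyp_isometry_inv hyp_isometry_rotation hyp_isometry_Moebius)
  moreover have "f (x i) = y i" if "i < n" for i
  proof -
    \<comment> \<open>Angles from the marked vertex are partial sums of side angles, so they agree
      in the two polygons.\<close>
    have "hangle c (x 0) (x i) = hangle c' (y 0) (y i)"
      unfolding cyclic_ngon_hangle_from_0[OF x that] cyclic_ngon_hangle_from_0[OF y that]
      using that angles by (intro sum.cong) auto
    then have "?M (x i) = ?M (x 0) * cis (hangle c' (y 0) (y i))"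
        "?N (y i) = ?N (y 0) * cis (hangle c' (y 0) (y i))"
      using Moebius_hangle[OF C(1,3) v(1)[OF \<open>0 < n\<close>] v(1)[OF that]]
        Moebius_hangle[OF C(2,3) v(2)[OF \<open>0 < n\<close>] v(2)[OF that]] by simp_all
    then have "u * ?M (x i) = ?N (y i)"
      using M0 by (simp add: u_def)
    then show ?thesis
      using hyp_isometry_inv_f[OF hyp_isometry_Moebius[OF C(2)], of "y i"] v(2)[OF that]
      by (simp add: f_def hcircle_def)
  qed
  ultimately show ?thesis
    by blast
qed

text \<open>With all angles at most \<open>pi\<close>, the thetas of the common side lengths sum to
  2 pi at both radii. Strict monotonicity in the radius forces equal radii, and then
  \<open>theta\<close> determines each angle.\<close>

lemma cyclic_ngons_isometric_if_same_sides:
  assumes x: "cyclic_ngon n c J x" and y: "cyclic_ngon n c' J' y" and "3 \<le> n"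
    and "side_lengths n x = side_lengths n y"
    and ax: "\<And>i. i < n \<Longrightarrow> hangle c (x (prev n i)) (x i) \<le> pi"
    and ay: "\<And>i. i < n \<Longrightarrow> hangle c' (y (prev n i)) (y i) \<le> pi"
  shows "\<exists>f. hyp_isometry f \<and> (\<forall>i<n. f (x i) = y i)"
proof -
  interpret X: cyclic_angles n J "\<lambda>i. hangle c (x (prev n i)) (x i)" "side_lengths n x"
    using x \<open>3 \<le> n\<close> by (rule cyclic_ngon_cyclic_angles)
  interpret Y: cyclic_angles n J' "\<lambda>i. hangle c' (y (prev n i)) (y i)" "side_lengths n x"
    unfolding assms(4) using y \<open>3 \<le> n\<close> by (rule cyclic_ngon_cyclic_angles)
  have "{..<n} \<noteq> {}"
    using \<open>3 \<le> n\<close> by (simp add: lessThan_empty_iff)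
  then have "\<not> J < J'" "\<not> J' < J"
    using sum_theta_strict_antimono[of "{..<n}" "side_lengths n x"] X.sum_theta[OF ax]
      Y.sum_theta[OF ay] X.side_pos X.radius_ge Y.radius_ge
    by fastforce+
  then have "J' = J"
    by simp
  moreover have "hangle c (x (prev n i)) (x i) = hangle c' (y (prev n i)) (y i)" if "i < n" for i
    using X.theta_eq[OF that ax] Y.theta_eq[OF that ay] that \<open>J' = J\<close> by simp
  ultimately show ?thesis
    using cyclic_ngons_isometric[of n c J x c' y] x y \<open>3 \<le> n\<close> by simp
qed

section \<open>Isometry classes\<close>

text \<open>\<open>hyp_isometry\<close> constrains a map only on \<open>hyp_plane\<close>, so
  symmetry uses that the vertices lie there: only then does the inverse map them back.\<close>

lemma ngon_isometric_equiv:
  assumes "\<forall>x\<in>M. \<forall>i<n. x i \<in> hyp_plane"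
  shows "equiv M (ngon_isometric n M)"
proof (rule equivI)
  show "ngon_isometric n M \<subseteq> M \<times> M"
    by (auto simp: ngon_isometric_def)
  show "refl_on M (ngon_isometric n M)"
    using hyp_isometry_id by (auto simp: ngon_isometric_def refl_on_def)
  show "sym (ngon_isometric n M)"
  proof (rule symI)
    fix x y
    assume "(x, y) \<in> ngon_isometric n M"
    then obtain f where *: "x \<in> M" "y \<in> M" "hyp_isometry f" "\<forall>i<n. f (x i) = y i"
      by (auto simp: ngon_isometric_def)
    then have "\<forall>i<n. inv_into hyp_plane f (y i) = x i"
      using assms hyp_isometry_inv_f by metis
    then show "(y, x) \<in> ngon_isometric n M"
      using * hyp_isometry_inv by (auto simp: ngon_isometric_def)
  qed
  show "trans (ngon_isometric n M)"
  proof (rule transI)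
    fix x y z
    assume "(x, y) \<in> ngon_isometric n M" "(y, z) \<in> ngon_isometric n M"
    then obtain f g where *: "x \<in> M" "z \<in> M" "hyp_isometry f" "\<forall>i<n. f (x i) = y i"
        "hyp_isometry g" "\<forall>i<n. g (y i) = z i"
      by (auto simp: ngon_isometric_def)
    then have "hyp_isometry (g \<circ> f)" "\<forall>i<n. (g \<circ> f) (x i) = z i"
      by (auto intro: hyp_isometry_comp)
    then show "(x, z) \<in> ngon_isometric n M"
      using * unfolding ngon_isometric_def by blast
  qed
qed

lemma ngon_isometric_side_lengths:
  assumes "\<forall>x\<in>M. \<forall>i<n. x i \<in> hyp_plane" "(x, y) \<in> ngon_isometric n M"
  shows "side_lengths n x = side_lengths n y"
proof -
  obtain f where f: "x \<in> M" "hyp_isometry f" "\<forall>i<n. f (x i) = y i"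
    using assms(2) by (auto simp: ngon_isometric_def)
  have "hdist (y (prev n i)) (y i) = hdist (x (prev n i)) (x i)" if "i < n" for i
  proof -
    have "hdist (f (x (prev n i))) (f (x i)) = hdist (x (prev n i)) (x i)"
      using f(1,2) assms(1) that prev_less unfolding hyp_isometry_def by blast
    then show ?thesis
      using f(3) that prev_less by simp
  qed
  then show ?thesis
    unfolding side_lengths_def by (intro restrict_ext) simp
qed

text \<open>Passes from classes to representatives: the image gives surjectivity, the last
  hypothesis injectivity, and congruence holds because isometries preserve distances.\<close>

lemma parametrizesI:
  assumes plane: "\<forall>x\<in>M. \<forall>i<n. x i \<in> hyp_plane"
    and image: "side_lengths n ` M = S"
    and inj: "\<And>x y. x \<in> M \<Longrightarrow> y \<in> M \<Longrightarrow> side_lengths n x = side_lengths n y \<Longrightarrow>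
      \<exists>f. hyp_isometry f \<and> (\<forall>i<n. f (x i) = y i)"
  shows "parametrizes n S M"
proof -
  let ?R = "ngon_isometric n M" and ?F = "\<lambda>K. the_elem (side_lengths n ` K)"
  have eq: "equiv M ?R"
    using plane by (rule ngon_isometric_equiv)
  have cong: "congruent ?R (side_lengths n)"
    using ngon_isometric_side_lengths[OF plane] by (auto simp: congruent_def)
  have F: "?F (?R `` {x}) = side_lengths n x" if "x \<in> M" for x
  proof -
    have "side_lengths n ` (?R `` {x}) = {side_lengths n x}"
      using cong equiv_class_self[OF eq that] by (force simp: congruent_def)
    then show ?thesis
      by simp
  qed
  have "inj_on ?F (M // ?R)"
  proof (rule inj_onI)
    fix K L
    assume "K \<in> M // ?R" "L \<in> M // ?R" and FKL: "?F K = ?F L"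
    then obtain x y where xy: "x \<in> M" "K = ?R `` {x}" "y \<in> M" "L = ?R `` {y}"
      by (auto elim!: quotientE)
    then have "(x, y) \<in> ?R"
      using FKL inj F by (simp add: ngon_isometric_def)
    then show "K = L"
      using xy equiv_class_eq[OF eq] by simp
  qed
  moreover have "?F ` (M // ?R) = S"
  proof (intro equalityI subsetI)
    fix d
    assume "d \<in> ?F ` (M // ?R)"
    then obtain x where "x \<in> M" "d = ?F (?R `` {x})"
      by (elim imageE quotientE) metis
    then show "d \<in> S"
      using F image by (metis imageI)
  next
    fix d
    assume "d \<in> S"
    then obtain x where "x \<in> M" "d = side_lengths n x"
      using image by blast
    then have "?R `` {x} \<in> M // ?R" "d = ?F (?R `` {x})"
      using F by (auto intro: quotientI)
    then show "d \<in> ?F ` (M // ?R)"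
      by (rule rev_image_eqI)
  qed
  ultimately show ?thesis
    using cong by (simp add: parametrizes_def bij_betw_def)
qed

section \<open>Side lengths of centered and semicyclic polygons\<close>

lemma cyclic_ngon_in_hyp_plane: "cyclic_ngon n c J x \<Longrightarrow> i < n \<Longrightarrow> x i \<in> hyp_plane"
  using cyclic_ngon_vertex by (auto simp: hcircle_def)

text \<open>The longest side is a diameter and subtends exactly \<open>pi\<close>; every other side
  subtends less.\<close>

lemma semicyclic_ngon_angles_le_pi:
  assumes "cyclic_ngon n c J x" "3 \<le> n" "J = Max (side_lengths n x ` {..<n}) / 2" "i < n"
  shows "hangle c (x (prev n i)) (x i) \<le> pi"
proof -
  interpret cyclic_angles n J "\<lambda>i. hangle c (x (prev n i)) (x i)" "side_lengths n x"
    using assms(1,2) by (rule cyclic_ngon_cyclic_angles)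
  obtain i0 where i0: "i0 < n" "Max (side_lengths n x ` {..<n}) = side_lengths n x i0"
      "\<And>i. i < n \<Longrightarrow> side_lengths n x i \<le> side_lengths n x i0"
    using obtain_max_index[of n "side_lengths n x"] assms(2) by auto
  show ?thesis
  proof (cases "i = i0")
    case True
    then show ?thesis
      using radius_eq_iff[OF i0(1,3)] assms(3) i0(2) by simp
  next
    case False
    then show ?thesis
      using angle_lt_pi_if_not_max[OF assms(4) i0(1) False i0(3)[OF assms(4)]] by simp
  qed
qed

text \<open>As the longest side does not subtend \<open>pi\<close>, the radius is strictly larger
  than half its length. The thetas sum to 2 pi at the radius, hence to more at the smaller
  value.\<close>

lemma centered_ngon_side_lengths:
  assumes "cyclic_ngon n c J x" "3 \<le> n" "\<forall>i<n. hangle c (x (prev n i)) (x i) < pi"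
  shows "side_lengths n x \<in> CC n"
proof -
  interpret cyclic_angles n J "\<lambda>i. hangle c (x (prev n i)) (x i)" "side_lengths n x"
    using assms(1,2) by (rule cyclic_ngon_cyclic_angles)
  obtain i0 where i0: "i0 < n" "Max (side_lengths n x ` {..<n}) = side_lengths n x i0"
      "\<And>i. i < n \<Longrightarrow> side_lengths n x i \<le> side_lengths n x i0"
    using obtain_max_index[of n "side_lengths n x"] assms(2) by auto
  have "J \<noteq> side_lengths n x i0 / 2"
    using radius_eq_iff[OF i0(1,3)] assms(3) i0(1) by auto
  then have "side_lengths n x i0 / 2 < J"
    using radius_ge[OF i0(1)] by simp
  then have "(\<Sum>i<n. theta (side_lengths n x i) J) <
      (\<Sum>i<n. theta (side_lengths n x i) (side_lengths n x i0 / 2))"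
    using i0 side_pos by (intro sum_theta_strict_antimono) auto
  moreover have "(\<Sum>i<n. theta (side_lengths n x i) J) = 2 * pi"
    using assms(3) by (intro sum_theta) (auto intro: less_imp_le)
  ultimately show ?thesis
    using assms(1) by (simp add: CC_def i0(2) cyclic_ngon_def)
qed

lemma semicyclic_ngon_side_lengths:
  assumes "cyclic_ngon n c J x" "3 \<le> n" "J = Max (side_lengths n x ` {..<n}) / 2"
  shows "side_lengths n x \<in> BC n"
proof -
  interpret cyclic_angles n J "\<lambda>i. hangle c (x (prev n i)) (x i)" "side_lengths n x"
    using assms(1,2) by (rule cyclic_ngon_cyclic_angles)
  have "(\<Sum>i<n. theta (side_lengths n x i) J) = 2 * pi"
    using semicyclic_ngon_angles_le_pi[OF assms] by (intro sum_theta) auto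
  then show ?thesis
    using assms(1) by (simp add: BC_def cyclic_ngon_def flip: assms(3))
qed

text \<open>The thetas themselves serve as the prescribed angles.\<close>

lemma exists_cyclic_ngon_radius:
  assumes "3 \<le> n" "d \<in> {..<n} \<rightarrow>\<^sub>E {0<..}" "0 < J"
    and "\<And>i. i < n \<Longrightarrow> d i / 2 \<le> J" "(\<Sum>i<n. theta (d i) J) = 2 * pi"
  shows "\<exists>x. cyclic_ngon n 0 J x \<and> side_lengths n x = d \<and>
    (\<forall>i<n. hangle 0 (x (prev n i)) (x i) = theta (d i) J)"
proof -
  have pos: "0 < d i" if "i < n" for i
    using assms(2) that by (auto simp: PiE_iff)
  interpret cyclic_angles n J "\<lambda>i. theta (d i) J" d
    using assms pos theta_pos sin_half_theta by unfold_locales auto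
  show ?thesis
    using assms(2) by (intro exists_cyclic_ngon) (simp add: PiE_iff)
qed

text \<open>At radius half the longest side the sum exceeds 2 pi, so some larger radius gives
  exactly 2 pi. Since that radius is larger than half of every side, each angle is below
  \<open>pi\<close>.\<close>

lemma CC_realized:
  assumes "3 \<le> n" "d \<in> CC n"
  shows "\<exists>x\<in>centered_ngons n. side_lengths n x = d"
proof -
  have d: "d \<in> {..<n} \<rightarrow>\<^sub>E {0<..}"
    using assms(2) by (simp add: CC_def)
  then have pos: "0 < d i" if "i < n" for i
    using that by (auto simp: PiE_iff)
  obtain i0 where i0: "i0 < n" "Max (d ` {..<n}) = d i0" "\<And>i. i < n \<Longrightarrow> d i \<le> d i0"
    using obtain_max_index[of n d] assms(1) by auto
  have "\<exists>J>d i0 / 2. (\<Sum>i<n. theta (d i) J) = 2 * pi"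
    using assms(2) i0 pos by (intro exists_radius_sum_theta_eq) (auto simp: CC_def)
  then obtain J where J: "d i0 / 2 < J" "(\<Sum>i<n. theta (d i) J) = 2 * pi"
    by blast
  have less: "d i / 2 < J" if "i < n" for i
    using J(1) i0(3)[OF that] by linarith
  then obtain x where x: "cyclic_ngon n 0 J x" "side_lengths n x = d"
      "\<forall>i<n. hangle 0 (x (prev n i)) (x i) = theta (d i) J"
    using exists_cyclic_ngon_radius[OF assms(1) d, of J] J pos[OF i0(1)] by (auto simp: less_eq_real_def)
  have "theta (d i) J < pi" if "i < n" for i
    using theta_strict_antimono[of "d i" "d i / 2" J] theta_self[of "d i / 2"] pos less that by simp
  then have "\<forall>i<n. hangle 0 (x (prev n i)) (x i) < pi"
    using x(3) by simp
  then have "x \<in> centered_ngons n"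
    unfolding centered_ngons_def using x(1) by (intro CollectI exI conjI)
  then show ?thesis
    using x(2) by blast
qed

text \<open>Half the longest side is already a radius at which the angle sum is 2 pi.\<close>

lemma BC_realized:
  assumes "3 \<le> n" "d \<in> BC n"
  shows "\<exists>x\<in>semicyclic_ngons n. side_lengths n x = d"
proof -
  have d: "d \<in> {..<n} \<rightarrow>\<^sub>E {0<..}"
    using assms(2) by (simp add: BC_def)
  obtain i0 where i0: "i0 < n" "Max (d ` {..<n}) = d i0" "\<And>i. i < n \<Longrightarrow> d i \<le> d i0"
    using obtain_max_index[of n d] assms(1) by auto
  have "0 < d i0"
    using d i0(1) by (auto simp: PiE_iff)
  then obtain x where x: "cyclic_ngon n 0 (d i0 / 2) x" "side_lengths n x = d"
    using exists_cyclic_ngon_radius[OF assms(1) d, of "d i0 / 2"] assms(2) i0 by (auto simp: BC_def)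
  have "d i0 / 2 = Max (side_lengths n x ` {..<n}) / 2"
    using x(2) i0(2) by simp
  then have "x \<in> semicyclic_ngons n"
    unfolding semicyclic_ngons_def using x(1) by (intro CollectI exI conjI)
  then show ?thesis
    using x(2) by blast
qed

lemma centered_ngonsE:
  assumes "x \<in> centered_ngons n"
  obtains c J where "cyclic_ngon n c J x" "\<forall>i<n. hangle c (x (prev n i)) (x i) < pi"
  using assms unfolding centered_ngons_def mem_Collect_eq by (elim exE conjE)

lemma parametrizes_centered_ngons:
  assumes "3 \<le> n"
  shows "parametrizes n (CC n) (centered_ngons n)"
proof (rule parametrizesI)
  show "\<forall>x\<in>centered_ngons n. \<forall>i<n. x i \<in> hyp_plane"
    by (intro ballI allI impI) (erule centered_ngonsE, rule cyclic_ngon_in_hyp_plane)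
  show "side_lengths n ` centered_ngons n = CC n"
  proof (intro equalityI subsetI)
    fix d
    assume "d \<in> CC n"
    then show "d \<in> side_lengths n ` centered_ngons n"
      using CC_realized[OF assms] by (metis image_eqI)
  next
    fix d
    assume "d \<in> side_lengths n ` centered_ngons n"
    then obtain x where "d = side_lengths n x" "x \<in> centered_ngons n"
      by (rule imageE)
    then show "d \<in> CC n"
      using centered_ngon_side_lengths[OF _ assms] centered_ngonsE by metis
  qed
  fix x y
  assume "x \<in> centered_ngons n" and "y \<in> centered_ngons n"
    and same: "side_lengths n x = side_lengths n y"
  obtain c J where x: "cyclic_ngon n c J x" "\<forall>i<n. hangle c (x (prev n i)) (x i) < pi"
    using \<open>x \<in> centered_ngons n\<close> by (rule centered_ngonsE)
  obtain c' J' where y: "cyclic_ngon n c' J' y" "\<forall>i<n. hangle c' (y (prev n i)) (y i) < pi"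
    using \<open>y \<in> centered_ngons n\<close> by (rule centered_ngonsE)
  have "hangle c (x (prev n i)) (x i) \<le> pi" "hangle c' (y (prev n i)) (y i) \<le> pi" if "i < n" for i
    using x(2) y(2) that by (simp_all add: less_imp_le)
  then show "\<exists>f. hyp_isometry f \<and> (\<forall>i<n. f (x i) = y i)"
    by (rule cyclic_ngons_isometric_if_same_sides[OF x(1) y(1) assms same])
qed

lemma semicyclic_ngonsE:
  assumes "x \<in> semicyclic_ngons n"
  obtains c J where "cyclic_ngon n c J x" "J = Max (side_lengths n x ` {..<n}) / 2"
  using assms unfolding semicyclic_ngons_def mem_Collect_eq by (elim exE conjE)

lemma parametrizes_semicyclic_ngons:
  assumes "3 \<le> n"
  shows "parametrizes n (BC n) (semicyclic_ngons n)"
proof (rule parametrizesI)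
  show "\<forall>x\<in>semicyclic_ngons n. \<forall>i<n. x i \<in> hyp_plane"
    by (intro ballI allI impI) (erule semicyclic_ngonsE, rule cyclic_ngon_in_hyp_plane)
  show "side_lengths n ` semicyclic_ngons n = BC n"
  proof (intro equalityI subsetI)
    fix d
    assume "d \<in> BC n"
    then show "d \<in> side_lengths n ` semicyclic_ngons n"
      using BC_realized[OF assms] by (metis image_eqI)
  next
    fix d
    assume "d \<in> side_lengths n ` semicyclic_ngons n"
    then obtain x where "d = side_lengths n x" "x \<in> semicyclic_ngons n"
      by (rule imageE)
    then show "d \<in> BC n"
      using semicyclic_ngon_side_lengths[OF _ assms] semicyclic_ngonsE by metis
  qed
  fix x y
  assume "x \<in> semicyclic_ngons n" and "y \<in> semicyclic_ngons n"
    and same: "side_lengths n x = side_lengths n y"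
  obtain c J where x: "cyclic_ngon n c J x" "J = Max (side_lengths n x ` {..<n}) / 2"
    using \<open>x \<in> semicyclic_ngons n\<close> by (rule semicyclic_ngonsE)
  obtain c' J' where y: "cyclic_ngon n c' J' y" "J' = Max (side_lengths n y ` {..<n}) / 2"
    using \<open>y \<in> semicyclic_ngons n\<close> by (rule semicyclic_ngonsE)
  show "\<exists>f. hyp_isometry f \<and> (\<forall>i<n. f (x i) = y i)"
    using semicyclic_ngon_angles_le_pi[OF x(1) assms x(2)]
      semicyclic_ngon_angles_le_pi[OF y(1) assms y(2)]
    by (rule cyclic_ngons_isometric_if_same_sides[OF x(1) y(1) assms same])
qed

theorem proposition1p11:
  fixes n :: nat
  assumes "n \<ge> 3"
  shows
    "(\<forall>c J x i0. cyclic_ngon n c J x \<and> i0 < n \<and>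
         (\<forall>i<n. side_lengths n x i \<le> side_lengths n x i0) \<longrightarrow>
         ((\<forall>i<n. hangle c (x (prev n i)) (x i) < pi) \<longleftrightarrow>
            (\<Sum>i\<in>{..<n} - {i0}. theta (side_lengths n x i) J) > pi) \<and>
         (J = side_lengths n x i0 / 2 \<longleftrightarrow>
            (\<Sum>i\<in>{..<n} - {i0}. theta (side_lengths n x i) J) = pi)) \<and>
     CC n \<subseteq> AC n \<and> parametrizes n (CC n) (centered_ngons n) \<and>
     BC n \<subseteq> AC n \<and> parametrizes n (BC n) (semicyclic_ngons n)"
proof (intro conjI)
  show "\<forall>c J x i0. cyclic_ngon n c J x \<and> i0 < n \<and>
         (\<forall>i<n. side_lengths n x i \<le> side_lengths n x i0) \<longrightarrow>
         ((\<forall>i<n. hangle c (x (prev n i)) (x i) < pi) \<longleftrightarrow>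
            (\<Sum>i\<in>{..<n} - {i0}. theta (side_lengths n x i) J) > pi) \<and>
         (J = side_lengths n x i0 / 2 \<longleftrightarrow>
            (\<Sum>i\<in>{..<n} - {i0}. theta (side_lengths n x i) J) = pi)"
  proof (intro allI impI)
    fix c J x i0
    assume "cyclic_ngon n c J x \<and> i0 < n \<and>
      (\<forall>i<n. side_lengths n x i \<le> side_lengths n x i0)"
    then have x: "cyclic_ngon n c J x"
      and i0: "i0 < n" "\<And>i. i < n \<Longrightarrow> side_lengths n x i \<le> side_lengths n x i0"
      by blast+
    interpret cyclic_angles n J "\<lambda>i. hangle c (x (prev n i)) (x i)" "side_lengths n x"
      using x assms by (rule cyclic_ngon_cyclic_angles)
    \<comment> \<open>Both criteria become statements about the angle of side \<open>i0\<close>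
      alone: being less than \<open>pi\<close>, and being equal to \<open>pi\<close>.\<close>
    have sum: "(\<Sum>i\<in>{..<n} - {i0}. theta (side_lengths n x i) J) =
        2 * pi - hangle c (x (prev n i0)) (x i0)"
      by (intro sum_theta_not_max i0)
    have all: "(\<forall>i<n. hangle c (x (prev n i)) (x i) < pi) \<longleftrightarrow> hangle c (x (prev n i0)) (x i0) < pi"
      by (intro all_angles_lt_pi_iff i0)
    have radius: "J = side_lengths n x i0 / 2 \<longleftrightarrow> hangle c (x (prev n i0)) (x i0) = pi"
      by (intro radius_eq_iff i0)
    have "(\<forall>i<n. hangle c (x (prev n i)) (x i) < pi) \<longleftrightarrow>
        pi < (\<Sum>i\<in>{..<n} - {i0}. theta (side_lengths n x i) J)"
      unfolding all sum by linarith
    moreover have "J = side_lengths n x i0 / 2 \<longleftrightarrow>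
        (\<Sum>i\<in>{..<n} - {i0}. theta (side_lengths n x i) J) = pi"
      unfolding radius sum by linarith
    ultimately show "((\<forall>i<n. hangle c (x (prev n i)) (x i) < pi) \<longleftrightarrow>
            (\<Sum>i\<in>{..<n} - {i0}. theta (side_lengths n x i) J) > pi) \<and>
         (J = side_lengths n x i0 / 2 \<longleftrightarrow>
            (\<Sum>i\<in>{..<n} - {i0}. theta (side_lengths n x i) J) = pi)"
      by (rule conjI)
  qed
  show "CC n \<subseteq> AC n" "BC n \<subseteq> AC n"
    using sum_theta_ge_imp_AC[OF assms] unfolding CC_def BC_def
    by (simp_all add: subset_iff less_imp_le)
qed (use assms parametrizes_centered_ngons parametrizes_semicyclic_ngons in auto)

end
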